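(* Let $E$ be a Dedekind complete Riesz space with weak order unit $e$, let $T$ be a strictly positive conditional expectation operator on $E$ with $Te=e$, and assume $E$ is $T$-universally complete ($E=L^1(T)$). Let $U$ and $V$ be conditional expectation operators on $E$ compatible with $T$. Then for every $f\in L^\infty(T)\cap R(V)$, $$\|Uf-Tf\|_{T,1}\le\|Uf-Tf\|_{T,\infty}\le 2\,\varphi_T(U,V)\,\|f\|_{T,\infty}.$$
   Context: A conditional expectation operator on a Dedekind complete Riesz space $E$ with weak order unit is a positive, order continuous, linear projection $T:E\to E$ whose range $R(T)$ is a Dedekind complete Riesz subspace of $E$ and such that $Te$ is a weak order unit of $E$ for every weak order unit $e$ of $E$. $T$ is strictly positive if $T|f|=0$ implies $f=0$. $E^u$ denotes the universal completion of $E$. $E$ is $T$-universally complete if for every upwards directed net $(f_\alpha)$ in $E_+$ with $(Tf_\alpha)$ order bounded in $E^u$, the net $(f_\alpha)$ is order convergent in $E$; then $L^1(T):=E$. Products are taken in the $f$-algebra $E^u$ with multiplicative unit $e$. $L^\infty(T):=\{f\in L^1(T): |f|\le g\text{ for some } g\in R(T)_+\}$, $\|f\|_{T,1}:=T|f|$, $\|f\|_{T,\infty}:=\inf\{g\in R(T)_+:|f|\le g\}$. A conditional expectation operator $U$ on $E$ is compatible with $T$ if $TU=T=UT$; $\mathcal{B}(U)$ is the set of band projections $P$ on $E$ with $Pe\in R(U)$. $\varphi_T(U,V):=\sup_{Q\in\mathcal{B}(V)}\|UQe-TQe\|_{T,\infty}$ (supremum in the order of $E$). *)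

theory Defs
  imports "HOL-Analysis.Analysis"
begin

text \<open>Convention: the type 'a models the universal completion E^u (a Dedekind complete
  real vector lattice, via the class conditionally_complete_lattice); the Riesz space E is a
  carrier set E :: 'a set. Operators on E are functions 'a => 'a, only their values on E matter.\<close>

definition absv :: "'a::{ordered_real_vector, lattice} \<Rightarrow> 'a" where
  "absv x = sup x (- x)"

definition riesz_subspace :: "'a::{ordered_real_vector, lattice} set \<Rightarrow> bool" where
  "riesz_subspace S \<longleftrightarrow> subspace S \<and> (\<forall>x\<in>S. \<forall>y\<in>S. sup x y \<in> S)"

definition is_sup_in :: "'a::order set \<Rightarrow> 'a set \<Rightarrow> 'a \<Rightarrow> bool" where
  "is_sup_in S A s \<longleftrightarrow> s \<in> S \<and> (\<forall>a\<in>A. a \<le> s) \<and> (\<forall>b\<in>S. (\<forall>a\<in>A. a \<le> b) \<longrightarrow> s \<le> b)"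

definition is_inf_in :: "'a::order set \<Rightarrow> 'a set \<Rightarrow> 'a \<Rightarrow> bool" where
  "is_inf_in S A s \<longleftrightarrow> s \<in> S \<and> (\<forall>a\<in>A. s \<le> a) \<and> (\<forall>b\<in>S. (\<forall>a\<in>A. b \<le> a) \<longrightarrow> b \<le> s)"

definition sup_in :: "'a::order set \<Rightarrow> 'a set \<Rightarrow> 'a" where
  "sup_in S A = (THE s. is_sup_in S A s)"

definition inf_in :: "'a::order set \<Rightarrow> 'a set \<Rightarrow> 'a" where
  "inf_in S A = (THE s. is_inf_in S A s)"

definition dedekind_complete_in :: "'a::order set \<Rightarrow> bool" where
  "dedekind_complete_in S \<longleftrightarrow>
     (\<forall>A. A \<subseteq> S \<and> A \<noteq> {} \<and> (\<exists>b\<in>S. \<forall>a\<in>A. a \<le> b) \<longrightarrow> (\<exists>s. is_sup_in S A s))"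

definition order_dense :: "'a::{ordered_real_vector, lattice} set \<Rightarrow> bool" where
  "order_dense S \<longleftrightarrow> (\<forall>u. 0 < u \<longrightarrow> (\<exists>x\<in>S. 0 < x \<and> x \<le> u))"

text \<open>Lateral completeness of the whole space 'a: every set of pairwise disjoint positive
  elements has a supremum (in a conditionally complete lattice: is bounded above).\<close>
definition laterally_complete :: "'a::{ordered_real_vector, conditionally_complete_lattice} itself \<Rightarrow> bool" where
  "laterally_complete _ \<longleftrightarrow>
     (\<forall>A::'a set. (\<forall>x\<in>A. 0 \<le> x) \<and> (\<forall>x\<in>A. \<forall>y\<in>A. x \<noteq> y \<longrightarrow> inf x y = 0) \<longrightarrow> bdd_above A)"

text \<open>'a (Dedekind complete by its class) is the universal completion of E: it is universally
  complete and contains E as an order dense Riesz subspace.\<close>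
definition universal_completion :: "'a::{ordered_real_vector, conditionally_complete_lattice} set \<Rightarrow> bool" where
  "universal_completion E \<longleftrightarrow> riesz_subspace E \<and> order_dense E \<and> laterally_complete TYPE('a)"

definition weak_order_unit :: "'a::{ordered_real_vector, lattice} set \<Rightarrow> 'a \<Rightarrow> bool" where
  "weak_order_unit E w \<longleftrightarrow> w \<in> E \<and> 0 \<le> w \<and> (\<forall>x\<in>E. inf (absv x) w = 0 \<longrightarrow> x = 0)"

definition f_algebra_unit :: "('a::{ordered_real_vector, lattice} \<Rightarrow> 'a \<Rightarrow> 'a) \<Rightarrow> 'a \<Rightarrow> bool" where
  "f_algebra_unit m e \<longleftrightarrow>
     (\<forall>x y z. m (x + y) z = m x z + m y z \<and> m z (x + y) = m z x + m z y) \<and>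
     (\<forall>c x y. m (c *\<^sub>R x) y = c *\<^sub>R m x y \<and> m x (c *\<^sub>R y) = c *\<^sub>R m x y) \<and>
     (\<forall>x y z. m (m x y) z = m x (m y z)) \<and>
     (\<forall>x y. 0 \<le> x \<and> 0 \<le> y \<longrightarrow> 0 \<le> m x y) \<and>
     (\<forall>x y z. inf x y = 0 \<and> 0 \<le> z \<longrightarrow> inf (m z x) y = 0 \<and> inf (m x z) y = 0) \<and>
     (\<forall>x. m e x = x \<and> m x e = x)"

definition linear_on :: "'a::real_vector set \<Rightarrow> ('a \<Rightarrow> 'a) \<Rightarrow> bool" where
  "linear_on E T \<longleftrightarrow> (\<forall>x\<in>E. T x \<in> E) \<and> (\<forall>x\<in>E. \<forall>y\<in>E. T (x + y) = T x + T y) \<and>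
     (\<forall>c. \<forall>x\<in>E. T (c *\<^sub>R x) = c *\<^sub>R T x)"

definition positive_on :: "'a::{ordered_real_vector} set \<Rightarrow> ('a \<Rightarrow> 'a) \<Rightarrow> bool" where
  "positive_on E T \<longleftrightarrow> (\<forall>x\<in>E. 0 \<le> x \<longrightarrow> 0 \<le> T x)"

definition up_directed :: "'a::order set \<Rightarrow> bool" where
  "up_directed D \<longleftrightarrow> D \<noteq> {} \<and> (\<forall>x\<in>D. \<forall>y\<in>D. \<exists>z\<in>D. x \<le> z \<and> y \<le> z)"

definition down_directed :: "'a::order set \<Rightarrow> bool" where
  "down_directed D \<longleftrightarrow> D \<noteq> {} \<and> (\<forall>x\<in>D. \<forall>y\<in>D. \<exists>z\<in>D. z \<le> x \<and> z \<le> y)"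

text \<open>Order continuity of a positive operator: x_alpha decreasing to 0 implies T x_alpha decreasing
  to 0 (nets represented by their ranges, i.e. directed sets).\<close>
definition order_continuous_on :: "'a::{ordered_real_vector} set \<Rightarrow> ('a \<Rightarrow> 'a) \<Rightarrow> bool" where
  "order_continuous_on E T \<longleftrightarrow>
     (\<forall>D. D \<subseteq> E \<and> down_directed D \<and> is_inf_in E D 0 \<longrightarrow> is_inf_in E (T ` D) 0)"

definition cond_exp :: "'a::{ordered_real_vector, lattice} set \<Rightarrow> ('a \<Rightarrow> 'a) \<Rightarrow> bool" where
  "cond_exp E T \<longleftrightarrow> linear_on E T \<and> positive_on E T \<and> order_continuous_on E T \<and>
     (\<forall>x\<in>E. T (T x) = T x) \<and>
     riesz_subspace (T ` E) \<and> dedekind_complete_in (T ` E) \<and>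
     (\<forall>w. weak_order_unit E w \<longrightarrow> weak_order_unit E (T w))"

definition strictly_positive :: "'a::{ordered_real_vector, lattice} set \<Rightarrow> ('a \<Rightarrow> 'a) \<Rightarrow> bool" where
  "strictly_positive E T \<longleftrightarrow> (\<forall>f\<in>E. T (absv f) = 0 \<longrightarrow> f = 0)"

text \<open>T-universal completeness (increasing nets represented by upward directed sets; an
  increasing net order converges iff its supremum exists).\<close>
definition T_universally_complete :: "'a::{ordered_real_vector, lattice} set \<Rightarrow> ('a \<Rightarrow> 'a) \<Rightarrow> bool" where
  "T_universally_complete E T \<longleftrightarrow>
     (\<forall>D. D \<subseteq> E \<and> (\<forall>x\<in>D. 0 \<le> x) \<and> up_directed D \<and> (\<exists>b. \<forall>x\<in>D. T x \<le> b)
        \<longrightarrow> (\<exists>s. is_sup_in E D s))"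

definition Linf :: "'a::{ordered_real_vector, lattice} set \<Rightarrow> ('a \<Rightarrow> 'a) \<Rightarrow> 'a set" where
  "Linf E T = {f\<in>E. \<exists>g\<in>T ` E. 0 \<le> g \<and> absv f \<le> g}"

definition norm_T1 :: "('a::{ordered_real_vector, lattice} \<Rightarrow> 'a) \<Rightarrow> 'a \<Rightarrow> 'a" where
  "norm_T1 T f = T (absv f)"

definition norm_Tinf :: "'a::{ordered_real_vector, lattice} set \<Rightarrow> ('a \<Rightarrow> 'a) \<Rightarrow> 'a \<Rightarrow> 'a" where
  "norm_Tinf E T f = inf_in E {g\<in>T ` E. 0 \<le> g \<and> absv f \<le> g}"

definition compatible :: "'a::{ordered_real_vector, lattice} set \<Rightarrow> ('a \<Rightarrow> 'a) \<Rightarrow> ('a \<Rightarrow> 'a) \<Rightarrow> bool" where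
  "compatible E T U \<longleftrightarrow> cond_exp E U \<and> (\<forall>x\<in>E. T (U x) = T x \<and> U (T x) = T x)"

definition ideal_in :: "'a::{ordered_real_vector, lattice} set \<Rightarrow> 'a set \<Rightarrow> bool" where
  "ideal_in E B \<longleftrightarrow> B \<subseteq> E \<and> subspace B \<and> (\<forall>x\<in>B. \<forall>y\<in>E. absv y \<le> absv x \<longrightarrow> y \<in> B)"

definition band_in :: "'a::{ordered_real_vector, lattice} set \<Rightarrow> 'a set \<Rightarrow> bool" where
  "band_in E B \<longleftrightarrow> ideal_in E B \<and> (\<forall>A s. A \<subseteq> B \<and> is_sup_in E A s \<longrightarrow> s \<in> B)"

definition disj_comp :: "'a::{ordered_real_vector, lattice} set \<Rightarrow> 'a set \<Rightarrow> 'a set" where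
  "disj_comp E B = {x\<in>E. \<forall>y\<in>B. inf (absv x) (absv y) = 0}"

definition band_projection :: "'a::{ordered_real_vector, lattice} set \<Rightarrow> ('a \<Rightarrow> 'a) \<Rightarrow> bool" where
  "band_projection E P \<longleftrightarrow>
     (\<exists>B. band_in E B \<and> (\<forall>x\<in>E. P x \<in> B \<and> x - P x \<in> disj_comp E B))"

definition BP :: "'a::{ordered_real_vector, lattice} set \<Rightarrow> 'a \<Rightarrow> ('a \<Rightarrow> 'a) \<Rightarrow> ('a \<Rightarrow> 'a) set" where
  "BP E e U = {P. band_projection E P \<and> P e \<in> U ` E}"

definition phi :: "'a::{ordered_real_vector, lattice} set \<Rightarrow> 'a \<Rightarrow> ('a \<Rightarrow> 'a) \<Rightarrow> ('a \<Rightarrow> 'a) \<Rightarrow> ('a \<Rightarrow> 'a) \<Rightarrow> 'a" where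
  "phi E e T U V = sup_in E ((\<lambda>Q. norm_Tinf E T (U (Q e) - T (Q e))) ` BP E e V)"

end

theory Submission
  imports Defs "HOL-Library.Lattice_Algebras"
begin

text \<open>Multiplication by a component c of e, an element with inf c (e - c) = 0, is a band projection.
  If f in the range of V satisfies |f| \<le> b e, then f + b e is a Riemann sum of components of e
  in the range of V up to an arbitrarily small multiple of e (layer cake), and U - T moves each of
  them by at most phi; this gives |U f - T f| \<le> 2 b phi. In general, put g = norm_Tinf f and cut
  with components c in the range of T on which g oscillates by at most d. Since c g is the infimum
  of g and a multiple of c, it lies in the range of T, so U, V and T commute with multiplication of f
  by c, and the first case applies to c f. Letting d tend to 0 gives the claim.\<close>

text \<open>The obstacle is multiplication. \<open>cond_exp\<close> contains no averaging identity S
  (g x) = g (S x), and \<open>f_algebra_unit\<close> contains no commutativity. What a range offers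
  is closure under linear and lattice operations and, by strict positivity, under suprema and
  infima. So products are taken with components, where they can be rewritten as infima, provided
  that the other factor is bounded there by a multiple of the component. This boundedness is why g
  is cut into levels. The factor 2 comes from replacing f by f + b e: positivity is gained, and the
  height to be covered by layers becomes 2 b.\<close>

interpretation lat: lattice_ab_group_add "(+)" "0 :: 'a::{ordered_real_vector, lattice}" "(-)" uminus
    "(\<le>)" "(<)" inf sup
  by unfold_locales

declare lat.neg_inf_eq_sup [simp del] lat.neg_sup_eq_inf [simp del]
  lat.diff_inf_eq_sup [simp del] lat.diff_sup_eq_inf [simp del]

section \<open>Absolute values, positive parts and disjointness\<close>

lemma absv_le_iff: "absv x \<le> y \<longleftrightarrow> x \<le> y \<and> - x \<le> y"
  by (simp add: absv_def)

lemma le_absv: "x \<le> absv x" and minus_le_absv: "- x \<le> absv x"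
  by (simp_all add: absv_def)

lemma absv_nonneg: "0 \<le> absv x"
proof -
  have "0 \<le> absv x + absv x"
    using add_mono[OF le_absv[of x] minus_le_absv[of x]] by simp
  then show ?thesis
    using lat.zero_le_double_add_iff_zero_le_single_add by blast
qed

lemma absv_of_nonneg: "0 \<le> x \<Longrightarrow> absv x = x"
  unfolding absv_def by (meson neg_le_0_iff_le order_trans sup_absorb1)

lemma pos_part_minus_neg_part: "sup x 0 - sup (- x) 0 = (x :: 'a::{ordered_real_vector, lattice})"
proof -
  have "sup (- x) 0 + x = sup x 0"
    by (simp add: lat.add_sup_distrib_right sup.commute)
  then show ?thesis by (simp add: algebra_simps)
qed

lemma inf_pos_part_neg_part: "inf (sup x 0) (sup (- x) 0) = (0 :: 'a::{ordered_real_vector, lattice})"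
proof -
  have "inf (sup x 0 - sup (- x) 0) 0 = - sup (- x) 0"
    unfolding pos_part_minus_neg_part by (simp add: lat.neg_sup_eq_inf)
  then have "inf (sup x 0 - sup (- x) 0) 0 + sup (- x) 0 = 0"
    by (metis add.left_inverse)
  then show ?thesis by (simp add: lat.add_inf_distrib_right)
qed

text \<open>The assumption makes - x a lower bound of both absolute values, hence of their infimum
  0. This later places \<open>Q e\<close> between 0 and e for a band projection Q.\<close>

lemma nonneg_of_disjoint_summands:
  fixes x y :: "'a::{ordered_real_vector, lattice}"
  assumes "inf (absv x) (absv y) = 0" "0 \<le> x + y"
  shows "0 \<le> x"
proof -
  have "- x \<le> y" using add_left_mono[OF assms(2), of "- x"] by simp
  then have "- x \<le> inf (absv x) (absv y)"
    by (meson le_absv le_infI minus_le_absv order_trans)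
  then show ?thesis using assms(1) by simp
qed

section \<open>Consequences of Dedekind completeness\<close>

text \<open>Each multiple of x is followed by another one, so the supremum s of all multiples
  satisfies s \<le> s - x.\<close>

lemma archimedean_le_zero:
  fixes x y :: "'a::{ordered_real_vector, conditionally_complete_lattice}"
  assumes le: "\<And>n::nat. real n *\<^sub>R x \<le> y"
  shows "x \<le> 0"
proof -
  let ?A = "range (\<lambda>n::nat. real n *\<^sub>R x)"
  have bdd: "bdd_above ?A" using le by (intro bdd_aboveI[of _ y]) auto
  have "Sup ?A \<le> Sup ?A - x"
  proof (rule cSup_least)
    fix a assume "a \<in> ?A"
    then obtain n :: nat where a: "a = real n *\<^sub>R x" by auto
    have "real (Suc n) *\<^sub>R x \<le> Sup ?A" using bdd by (intro cSup_upper) (rule rangeI)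
    then show "a \<le> Sup ?A - x" by (simp add: a algebra_simps)
  qed simp
  then show ?thesis by simp
qed

lemma le_of_le_add_scaleR:
  fixes x y b :: "'a::{ordered_real_vector, conditionally_complete_lattice}"
  assumes "\<And>n::nat. 0 < n \<Longrightarrow> x \<le> y + (1 / real n) *\<^sub>R b" "0 \<le> b"
  shows "x \<le> y"
proof -
  have "real n *\<^sub>R (x - y) \<le> b" for n :: nat
  proof (cases "n = 0")
    case False
    then have "x - y \<le> (1 / real n) *\<^sub>R b"
      using assms(1)[of n] by (simp add: algebra_simps)
    then have "real n *\<^sub>R (x - y) \<le> real n *\<^sub>R ((1 / real n) *\<^sub>R b)"
      by (intro scaleR_left_mono) auto
    then show ?thesis using False by simp
  qed (use assms in simp)
  from archimedean_le_zero[OF this] show ?thesis by simp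
qed

text \<open>One half of the distributivity of infima over suprema: lowering Sup A to a member a
  lowers the infimum with b by at most Sup A - a.\<close>

lemma inf_cSup_le:
  fixes A :: "'a::{ordered_real_vector, conditionally_complete_lattice} set"
  assumes "A \<noteq> {}" "bdd_above A" "\<And>a. a \<in> A \<Longrightarrow> inf a b \<le> z"
  shows "inf (Sup A) b \<le> z"
proof -
  have "Sup A \<le> Sup A - inf (Sup A) b + z"
  proof (rule cSup_least)
    fix a assume a: "a \<in> A"
    then have "a \<le> Sup A" using assms(2) by (rule cSup_upper)
    then have "inf (Sup A) b + (a - Sup A) \<le> inf a b"
      by (simp add: lat.add_inf_distrib_right le_infI2)
    also have "\<dots> \<le> z" using assms(3)[OF a] .
    finally show "a \<le> Sup A - inf (Sup A) b + z" by (simp add: algebra_simps)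
  qed fact
  then show ?thesis by (simp add: algebra_simps)
qed

lemma scaleR_inf:
  fixes x y :: "'a::{ordered_real_vector, lattice}"
  assumes "0 < r"
  shows "r *\<^sub>R inf x y = inf (r *\<^sub>R x) (r *\<^sub>R y)"
proof (rule order.antisym)
  show "r *\<^sub>R inf x y \<le> inf (r *\<^sub>R x) (r *\<^sub>R y)"
    using assms by (auto intro!: scaleR_left_mono)
  have "inverse r *\<^sub>R inf (r *\<^sub>R x) (r *\<^sub>R y) \<le> inf x y"
    using assms scaleR_left_mono[of "inf (r *\<^sub>R x) (r *\<^sub>R y)" "r *\<^sub>R x" "inverse r"]
      scaleR_left_mono[of "inf (r *\<^sub>R x) (r *\<^sub>R y)" "r *\<^sub>R y" "inverse r"]
    by (intro le_infI) auto
  then have "r *\<^sub>R (inverse r *\<^sub>R inf (r *\<^sub>R x) (r *\<^sub>R y)) \<le> r *\<^sub>R inf x y"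
    using assms by (intro scaleR_left_mono) auto
  then show "inf (r *\<^sub>R x) (r *\<^sub>R y) \<le> r *\<^sub>R inf x y" using assms by simp
qed

text \<open>By order density, x is the supremum of the members of E below it.\<close>

lemma dedekind_complete_order_dense_solid:
  fixes E :: "'a::{ordered_real_vector, conditionally_complete_lattice} set"
  assumes E: "riesz_subspace E" and dense: "order_dense E" and compl: "dedekind_complete_in E"
    and y: "y \<in> E" and x: "0 \<le> x" "x \<le> y"
  shows "x \<in> E"
proof -
  have sub: "subspace E" using E by (simp add: riesz_subspace_def)
  let ?A = "{a \<in> E. 0 \<le> a \<and> a \<le> x}"
  have ne: "?A \<noteq> {}" using subspace_0[OF sub] x by auto
  have bdd: "bdd_above ?A" by (auto intro: bdd_aboveI)
  have "Sup ?A \<le> x" using ne by (rule cSup_least) auto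
  have Sup: "Sup ?A = x"
  proof (rule ccontr)
    assume "Sup ?A \<noteq> x"
    then have "0 < x - Sup ?A" using \<open>Sup ?A \<le> x\<close> by (simp add: order.strict_iff_order)
    then obtain d where d: "d \<in> E" "0 < d" "d \<le> x - Sup ?A"
      using dense unfolding order_dense_def by blast
    have "Sup ?A \<le> Sup ?A - d"
    proof (rule cSup_least[OF ne])
      fix a assume a: "a \<in> ?A"
      have "a \<le> Sup ?A" using a bdd by (rule cSup_upper)
      then have "a + d \<le> Sup ?A + (x - Sup ?A)" using d(3) by (rule add_mono)
      then have "a + d \<in> ?A" using a d subspace_add[OF sub] by (auto simp: add_nonneg_nonneg less_imp_le)
      then have "a + d \<le> Sup ?A" using bdd by (rule cSup_upper)
      then show "a \<le> Sup ?A - d" by (simp add: algebra_simps)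
    qed
    then show False using d(2) by (simp add: algebra_simps less_le_not_le)
  qed
  have "\<exists>b\<in>E. \<forall>a\<in>?A. a \<le> b" using y x by (auto intro: order_trans)
  then obtain s where "is_sup_in E ?A s"
    using compl ne unfolding dedekind_complete_in_def by (metis (no_types, lifting) mem_Collect_eq subsetI)
  then have s: "s \<in> E" "\<And>a. a \<in> ?A \<Longrightarrow> a \<le> s"
    "\<And>b. b \<in> E \<Longrightarrow> (\<And>a. a \<in> ?A \<Longrightarrow> a \<le> b) \<Longrightarrow> s \<le> b"
    unfolding is_sup_in_def by blast+
  have "x \<le> s" using cSup_least[OF ne s(2)] Sup by simp
  \<comment> \<open>The supremum relative to \<open>E\<close> could a priori exceed the one in the
    whole type; an element of \<open>E\<close> in the gap would give a smaller upper bound.\<close>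
  have "s = x"
  proof (rule ccontr)
    assume "s \<noteq> x"
    then have "0 < s - x" using \<open>x \<le> s\<close> by (simp add: order.strict_iff_order)
    then obtain d where d: "d \<in> E" "0 < d" "d \<le> s - x"
      using dense unfolding order_dense_def by blast
    have "x \<le> s - d" using d(3) by (simp add: algebra_simps)
    then have "s \<le> s - d" using d(1) s(1) subspace_diff[OF sub] by (intro s(3)) auto
    then show False using d(2) by (simp add: less_le_not_le)
  qed
  then show ?thesis using s(1) by simp
qed

section \<open>Multiplication in a unital f-algebra\<close>

locale unital_f_algebra =
  fixes m :: "'a::{ordered_real_vector, conditionally_complete_lattice} \<Rightarrow> 'a \<Rightarrow> 'a" and e :: 'a
  assumes f_algebra: "f_algebra_unit m e" and unit_nonneg: "0 \<le> e"
begin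

lemma m_add_left: "m (x + y) z = m x z + m y z"
  and m_add_right: "m z (x + y) = m z x + m z y"
  and m_scaleR_left: "m (r *\<^sub>R x) y = r *\<^sub>R m x y"
  and m_scaleR_right: "m x (r *\<^sub>R y) = r *\<^sub>R m x y"
  and m_assoc: "m (m x y) z = m x (m y z)"
  and m_unit: "m e x = x" "m x e = x"
  using f_algebra by (simp_all add: f_algebra_unit_def)

lemma m_nonneg: "0 \<le> x \<Longrightarrow> 0 \<le> y \<Longrightarrow> 0 \<le> m x y"
  using f_algebra unfolding f_algebra_unit_def by blast

lemma m_disjoint:
  assumes "inf x y = 0" "0 \<le> z"
  shows "inf (m z x) y = 0" "inf (m x z) y = 0"
  using f_algebra assms unfolding f_algebra_unit_def by blast+

lemma m_minus_left: "m (- x) y = - m x y"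
  using m_scaleR_left[of "-1" x y] by simp

lemma m_minus_right: "m x (- y) = - m x y"
  using m_scaleR_right[of x "-1" y] by simp

lemma m_diff_left: "m (x - y) z = m x z - m y z"
  using m_add_left[of x "- y" z] by (simp add: m_minus_left)

lemma m_diff_right: "m z (x - y) = m z x - m z y"
  using m_add_right[of z x "- y"] by (simp add: m_minus_right)

lemma m_zero_right: "m z 0 = 0"
  using m_diff_right[of z 0 0] by simp

lemma m_mono_right: "0 \<le> z \<Longrightarrow> x \<le> y \<Longrightarrow> m z x \<le> m z y"
  using m_nonneg[of z "y - x"] by (simp add: m_diff_right)

lemma m_mono_left: "0 \<le> z \<Longrightarrow> x \<le> y \<Longrightarrow> m x z \<le> m y z"
  using m_nonneg[of "y - x" z] by (simp add: m_diff_left)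

text \<open>Two uses of the f-algebra axiom make \<open>m x y\<close> disjoint from y and then from
  itself.\<close>

lemma m_eq_zero_of_disjoint:
  assumes "inf x y = 0"
  shows "m x y = 0"
proof -
  have nn: "0 \<le> x" "0 \<le> y" using assms by (metis inf_le1, metis inf_le2)
  have "inf y (m x y) = 0" using m_disjoint(2)[OF assms nn(2)] by (simp add: inf.commute)
  from m_disjoint(1)[OF this nn(1)] show ?thesis by simp
qed

section \<open>Components of the unit and components generated by elements\<close>

definition component :: "'a \<Rightarrow> bool" where
  "component c \<longleftrightarrow> inf c (e - c) = 0"

lemma component_compl: "component c \<Longrightarrow> component (e - c)"
  by (simp add: component_def inf.commute)

lemma component_nonneg: "component c \<Longrightarrow> 0 \<le> c"
  unfolding component_def by (metis inf_le1)

lemma component_le_unit: "component c \<Longrightarrow> c \<le> e"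
  using component_nonneg[OF component_compl] by simp

lemma component_split: "m c x + m (e - c) x = x"
  by (simp add: m_diff_left m_unit)

lemma component_m_le: "component c \<Longrightarrow> 0 \<le> x \<Longrightarrow> m c x \<le> x"
  using m_mono_left[of x c e] component_le_unit m_unit by simp

lemma component_m_nonneg: "component c \<Longrightarrow> 0 \<le> x \<Longrightarrow> 0 \<le> m c x"
  using m_nonneg component_nonneg by blast

lemma component_m_mono: "component c \<Longrightarrow> x \<le> y \<Longrightarrow> m c x \<le> m c y"
  using m_mono_right component_nonneg by blast

lemma component_absv_le: "component c \<Longrightarrow> absv (m c x) \<le> m c (absv x)"
  using component_m_mono[OF _ le_absv, of c x] component_m_mono[OF _ minus_le_absv, of c x]
  by (simp add: absv_le_iff m_minus_right)

lemma component_absv_le_absv: "component c \<Longrightarrow> absv (m c x) \<le> absv x"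
  using component_absv_le component_m_le absv_nonneg order_trans by blast

lemma component_idem: "component c \<Longrightarrow> m c c = c"
  using m_eq_zero_of_disjoint[of c "e - c"]
  by (simp add: component_def m_diff_right m_unit)

lemma component_m_idem: "component c \<Longrightarrow> m c (m c x) = m c x"
  using component_idem m_assoc by metis

lemma component_m_compl: "component c \<Longrightarrow> m c (m (e - c) x) = 0"
  by (simp add: m_diff_left m_unit m_diff_right component_m_idem)

lemma component_disjoint:
  assumes "component c" "0 \<le> x" "0 \<le> y"
  shows "inf (m c x) (m (e - c) y) = 0"
proof -
  have "inf (m c x) (e - c) = 0"
    using m_disjoint(2) assms by (simp add: component_def)
  then have "inf (e - c) (m c x) = 0" by (simp add: inf.commute)
  from m_disjoint(2)[OF this assms(3)] show ?thesis by (simp add: inf.commute)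
qed

text \<open>Both products are disjoint from \<open>e - c\<close>, so both are left unchanged by a
  further factor c on the free side, and both equal c x c.\<close>

lemma component_m_commute:
  assumes c: "component c" and x: "0 \<le> x"
  shows "m c x = m x c"
proof -
  have "inf (e - c) c = 0" using c by (simp add: component_def inf.commute)
  then have "inf (m x c) (e - c) = 0"
    using m_disjoint(1)[of c "e - c" x] x by (simp add: inf.commute)
  then have "inf (e - c) (m x c) = 0" by (simp add: inf.commute)
  then have 1: "m (e - c) (m x c) = 0" by (rule m_eq_zero_of_disjoint)
  have "inf (m c x) (e - c) = 0" using m_disjoint(2) c x by (simp add: component_def)
  then have 2: "m (m c x) (e - c) = 0" by (rule m_eq_zero_of_disjoint)
  from 1 2 show ?thesis by (simp add: m_diff_left m_diff_right m_unit m_assoc)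
qed

lemma component_m_left_commute:
  "component c \<Longrightarrow> component d \<Longrightarrow> m c (m d x) = m d (m c x)"
  using component_m_commute component_nonneg m_assoc by metis

text \<open>Turns a product into a lattice operation, under which ranges are closed. The infimum z
  lies below a multiple of c, so \<open>e - c\<close> annihilates it and z \<le> c z \<le> c
  x.\<close>

lemma component_m_eq_inf:
  assumes c: "component c" and x: "0 \<le> x" and r: "0 \<le> r" and le: "m c x \<le> r *\<^sub>R c"
  shows "m c x = inf x (r *\<^sub>R c)"
proof (rule order.antisym)
  show "m c x \<le> inf x (r *\<^sub>R c)" using component_m_le[OF c x] le by simp
  let ?z = "inf x (r *\<^sub>R c)"
  have z: "0 \<le> ?z" using x r component_nonneg[OF c] by (simp add: scaleR_nonneg_nonneg)
  have "m (e - c) ?z \<le> m (e - c) (r *\<^sub>R c)"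
    by (intro component_m_mono component_compl c) simp
  also have "\<dots> = 0" by (simp add: m_scaleR_right m_diff_left m_unit component_idem[OF c])
  finally have "?z \<le> m c ?z" using component_split[of c ?z]
    by (metis add.commute add_le_same_cancel2)
  also have "\<dots> \<le> m c x" by (intro component_m_mono c) simp
  finally show "?z \<le> m c x" .
qed

text \<open>For the second claim split the infimum of c d and e - c d along c: its part off c
  vanishes because it lies below c, and its part on c lies below both d and e - d.\<close>

lemma component_m_component:
  assumes c: "component c" and d: "component d"
  shows "m c d = inf d c" "component (m c d)"
proof -
  have le: "m c d \<le> c" 
    using m_mono_right[OF component_nonneg[OF c] component_le_unit[OF d]] by (simp add: m_unit)
  show eq: "m c d = inf d c"
    using component_m_eq_inf[OF c component_nonneg[OF d], of 1] le by simp
  have nn: "0 \<le> m c d" using component_m_nonneg[OF c component_nonneg[OF d]] .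
  let ?z = "inf (m c d) (e - m c d)"
  have z: "0 \<le> ?z" using nn le component_le_unit[OF c] by auto
  have z_le: "?z \<le> c" "?z \<le> d" using eq by (simp_all add: le_infI1)
  have "m (e - c) ?z \<le> m (e - c) c"
    by (intro component_m_mono component_compl c z_le)
  also have "\<dots> = 0" by (simp add: m_diff_left m_unit component_idem[OF c])
  finally have "m (e - c) ?z \<le> 0" .
  have "m c ?z \<le> m c (e - m c d)" by (intro component_m_mono c) simp
  also have "\<dots> = m c (e - d)" by (simp add: m_diff_right m_unit component_m_idem[OF c])
  also have "\<dots> \<le> e - d" using component_m_le[OF c component_nonneg[OF component_compl[OF d]]] .
  finally have "m c ?z \<le> inf d (e - d)"
    using order_trans[OF component_m_le[OF c z] z_le(2)] by simp
  then have "m c ?z \<le> 0" using d unfolding component_def by metis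
  with \<open>m (e - c) ?z \<le> 0\<close> have "?z \<le> 0"
    using component_split[of c ?z] add_nonpos_nonpos by metis
  then show "component (m c d)" using z by (simp add: component_def)
qed

text \<open>The component of e in the band generated by u.\<close>

definition chi :: "'a \<Rightarrow> 'a" where
  "chi u = Sup (range (\<lambda>n::nat. inf (real n *\<^sub>R u) e))"

lemma chi_bdd: "bdd_above (range (\<lambda>n::nat. inf (real n *\<^sub>R u) e))"
  by (auto intro!: bdd_aboveI[of _ e])

lemma chi_upper: "inf (real n *\<^sub>R u) e \<le> chi u"
  unfolding chi_def by (rule cSup_upper[OF _ chi_bdd]) auto

lemma chi_least: "(\<And>n::nat. inf (real n *\<^sub>R u) e \<le> z) \<Longrightarrow> chi u \<le> z"
  unfolding chi_def by (rule cSup_least) auto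

lemma chi_nonneg: "0 \<le> chi u"
  using chi_upper[of 0 u] unit_nonneg by (simp add: inf_absorb1)

lemma chi_le_unit: "chi u \<le> e"
  by (rule chi_least) simp

text \<open>Doubling a multiple of u stays within the family, so c = \<open>chi u\<close> satisfies
  inf (2 c) e \<le> c; subtracting c gives disjointness from e - c. The estimate is first proved at
  half scale, so that the supremum itself enters \<open>inf_cSup_le\<close>.\<close>

lemma component_chi:
  assumes u: "0 \<le> u"
  shows "component (chi u)"
proof -
  let ?c = "chi u"
  have "inf ?c ((1/2) *\<^sub>R e) \<le> (1/2) *\<^sub>R ?c"
    unfolding chi_def[of u]
  proof (rule inf_cSup_le[OF _ chi_bdd])
    fix a assume "a \<in> range (\<lambda>n::nat. inf (real n *\<^sub>R u) e)"
    then obtain n :: nat where a: "a = inf (real n *\<^sub>R u) e" by auto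
    have "inf a ((1/2) *\<^sub>R e) \<le> inf ((1/2) *\<^sub>R (real (2 * n) *\<^sub>R u)) ((1/2) *\<^sub>R e)"
      by (auto simp: a intro: le_infI1)
    also have "\<dots> = (1/2) *\<^sub>R inf (real (2 * n) *\<^sub>R u) e" by (simp only: scaleR_inf)
    also have "\<dots> \<le> (1/2) *\<^sub>R chi u" using chi_upper[of "2 * n" u] by (intro scaleR_left_mono) auto
    finally show "inf a ((1/2) *\<^sub>R e) \<le> (1/2) *\<^sub>R Sup (range (\<lambda>n::nat. inf (real n *\<^sub>R u) e))"
      by (simp add: chi_def)
  qed simp
  then have "2 *\<^sub>R inf ?c ((1/2) *\<^sub>R e) \<le> 2 *\<^sub>R ((1/2) *\<^sub>R ?c)" by (intro scaleR_left_mono) auto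
  then have "inf (2 *\<^sub>R ?c) e \<le> ?c" by (simp add: scaleR_inf)
  then have "inf (2 *\<^sub>R ?c) e + - ?c \<le> 0" by simp
  then have "inf ?c (e - ?c) \<le> 0"
    unfolding lat.add_inf_distrib_right by (simp add: scaleR_2)
  then show ?thesis
    using chi_nonneg[of u] chi_le_unit[of u] by (auto simp: component_def intro: order.antisym)
qed

text \<open>Since e - chi u lies below e, it meets u only inside \<open>inf u e\<close>, the term n
  = 1 of the supremum, which is below \<open>chi u\<close>.\<close>

lemma chi_m_self:
  assumes u: "0 \<le> u"
  shows "m (chi u) u = u"
proof -
  have "inf (e - chi u) u = inf (e - chi u) (inf u e)"
    using chi_nonneg[of u] by (metis (no_types) inf.absorb2 inf.assoc inf.commute diff_le_eq le_add_same_cancel1)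
  also have "\<dots> \<le> inf (e - chi u) (chi u)"
    using chi_upper[of 1 u] by (intro inf_mono) auto
  also have "\<dots> = 0" using component_chi[OF u] by (simp add: component_def inf.commute)
  finally have "inf (e - chi u) u = 0"
    using u chi_le_unit[of u] by (intro order.antisym) auto
  from m_eq_zero_of_disjoint[OF this] show ?thesis by (simp add: m_diff_left m_unit)
qed

lemma chi_m_disjoint:
  assumes "inf u v = 0"
  shows "m (chi u) v = 0"
proof (rule m_eq_zero_of_disjoint, rule order.antisym)
  have nn: "0 \<le> u" "0 \<le> v" using assms by (metis inf_le1, metis inf_le2)
  then show "0 \<le> inf (chi u) v" using chi_nonneg by simp
  show "inf (chi u) v \<le> 0"
    unfolding chi_def
  proof (rule inf_cSup_le[OF _ chi_bdd])
    fix a assume "a \<in> range (\<lambda>n::nat. inf (real n *\<^sub>R u) e)"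
    then obtain n :: nat where a: "a = inf (real n *\<^sub>R u) e" by auto
    have "inf (m (real n *\<^sub>R e) u) v = 0"
      using m_disjoint(1)[OF assms] unit_nonneg by (simp add: scaleR_nonneg_nonneg)
    then have "inf (real n *\<^sub>R u) v = 0" by (simp add: m_scaleR_left m_unit)
    moreover have "inf a v \<le> inf (real n *\<^sub>R u) v" unfolding a by (intro inf_mono) auto
    ultimately show "inf a v \<le> 0" by simp
  qed simp
qed

text \<open>\<open>chi (sup x 0)\<close> acts as the indicator of the set where x is positive: it
  fixes the positive part and annihilates the disjoint negative part.\<close>

lemma chi_pos_part:
  "component (chi (sup x 0))" "m (chi (sup x 0)) x = sup x 0"
  "m (e - chi (sup x 0)) x \<le> 0"
proof -
  show "component (chi (sup x 0))" by (simp add: component_chi)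
  have "m (chi (sup x 0)) (sup x 0 - sup (- x) 0) = sup x 0"
    using chi_m_self[of "sup x 0"] chi_m_disjoint[OF inf_pos_part_neg_part[of x]]
    by (simp add: m_diff_right)
  then show eq: "m (chi (sup x 0)) x = sup x 0" by (simp add: pos_part_minus_neg_part)
  show "m (e - chi (sup x 0)) x \<le> 0"
    by (simp add: m_diff_left m_unit eq)
qed

text \<open>The positive part is itself x times a component, and multiplications by components can
  be exchanged.\<close>

lemma component_m_pos_part_le:
  assumes "component c" "m c x \<le> 0"
  shows "m c (sup x 0) \<le> 0"
proof -
  let ?d = "chi (sup x 0)"
  have "m c (sup x 0) = m ?d (m c x)"
    using component_m_left_commute[OF assms(1) chi_pos_part(1)] chi_pos_part(2)[of x] by metis
  also have "\<dots> \<le> m ?d 0" using assms(2) by (intro component_m_mono chi_pos_part(1))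
  finally show ?thesis by (simp add: m_zero_right)
qed

section \<open>Layer cake sums and levels\<close>

text \<open>Together with the next lemma this brackets one layer, as for functions: r times the
  indicator of u > r is at most min(u, r), which is at most r times the indicator of u > 0.\<close>

lemma inf_scaleR_unit_le:
  assumes u: "0 \<le> u" and r: "0 \<le> r"
  shows "inf u (r *\<^sub>R e) \<le> r *\<^sub>R chi u"
proof -
  have "m (e - chi u) (inf u (r *\<^sub>R e)) \<le> m (e - chi u) u"
    by (intro component_m_mono component_compl component_chi u) simp
  also have "\<dots> = 0" by (simp add: m_diff_left m_unit chi_m_self[OF u])
  finally have "inf u (r *\<^sub>R e) \<le> m (chi u) (inf u (r *\<^sub>R e))"
    using component_split[of "chi u" "inf u (r *\<^sub>R e)"] by (metis add.commute add_le_same_cancel2)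
  also have "\<dots> \<le> m (chi u) (r *\<^sub>R e)" by (intro component_m_mono component_chi u) simp
  finally show ?thesis by (simp add: m_scaleR_right m_unit)
qed

lemma chi_le_inf_scaleR_unit:
  assumes u: "0 \<le> u" and r: "0 \<le> r"
  shows "r *\<^sub>R chi (sup (u - r *\<^sub>R e) 0) \<le> inf u (r *\<^sub>R e)"
proof -
  let ?d = "chi (sup (u - r *\<^sub>R e) 0)"
  have "0 \<le> m ?d (u - r *\<^sub>R e)" by (simp add: chi_pos_part(2))
  then have "r *\<^sub>R ?d \<le> m ?d u" by (simp add: m_diff_right m_scaleR_right m_unit)
  also have "\<dots> \<le> u" by (intro component_m_le chi_pos_part(1) u)
  finally show ?thesis using chi_le_unit r by (auto intro: scaleR_left_mono)
qed

text \<open>Writing a layer as a difference of two truncations of x lets the sum over all layers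
  telescope.\<close>

lemma layer_step:
  assumes "0 \<le> r"
  shows "inf (sup (x - a) 0) (r *\<^sub>R e) = inf x (a + r *\<^sub>R e) - inf x a"
proof -
  have nn: "0 \<le> r *\<^sub>R e" using assms unit_nonneg by (simp add: scaleR_nonneg_nonneg)
  have "sup (x - a) 0 + inf x a = x"
  proof -
    have "x + sup (- a) (- x) = sup (x - a) 0" by (simp add: lat.add_sup_distrib_left)
    moreover have "sup (- a) (- x) = - inf x a" by (simp add: lat.neg_inf_eq_sup sup.commute)
    ultimately show ?thesis by (metis diff_add_cancel add_uminus_conv_diff)
  qed
  then have "inf (sup (x - a) 0) (r *\<^sub>R e) + inf x a = inf x (r *\<^sub>R e + inf x a)"
    by (simp add: lat.add_inf_distrib_right)
  also have "\<dots> = inf (inf x (r *\<^sub>R e + x)) (a + r *\<^sub>R e)"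
    by (simp add: lat.add_inf_distrib_left lat.add_inf_distrib_right inf.assoc add.commute)
  also have "inf x (r *\<^sub>R e + x) = x" using nn by (simp add: inf_absorb1)
  finally show ?thesis by (simp add: algebra_simps)
qed

text \<open>Layer i lies between r q(i+1) and r q(i), and the layers add up to x. Lower and upper
  sums differ only by an index shift, which costs at most r q(0) \<le> r e.\<close>

lemma layer_cake:
  fixes N :: nat
  assumes x: "0 \<le> x" "x \<le> (real N * r) *\<^sub>R e" and r: "0 \<le> r"
  defines "q \<equiv> \<lambda>i::nat. chi (sup (x - (real i * r) *\<^sub>R e) 0)"
  shows "(\<Sum>i<N. r *\<^sub>R q (Suc i)) \<le> x" "x \<le> (\<Sum>i<N. r *\<^sub>R q (Suc i)) + r *\<^sub>R e"
proof -
  have step: "r *\<^sub>R q (Suc n) \<le> inf x ((real (Suc n) * r) *\<^sub>R e) - inf x ((real n * r) *\<^sub>R e)"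
    "inf x ((real (Suc n) * r) *\<^sub>R e) - inf x ((real n * r) *\<^sub>R e) \<le> r *\<^sub>R q n" for n
  proof -
    let ?a = "(real n * r) *\<^sub>R e"
    let ?u = "sup (x - ?a) 0"
    have sc: "(real (Suc n) * r) *\<^sub>R e = ?a + r *\<^sub>R e" by (simp add: algebra_simps)
    have eq: "inf ?u (r *\<^sub>R e) = inf x ((real (Suc n) * r) *\<^sub>R e) - inf x ?a"
      unfolding sc by (rule layer_step[OF r])
    have nn: "- (r *\<^sub>R e) \<le> 0" using r unit_nonneg by (simp add: scaleR_nonneg_nonneg)
    \<comment> \<open>Cutting the shifted element at height r is cutting x at the next grid point,
      so the lower bracket of layer n carries the index Suc n.\<close>
    have "?u - r *\<^sub>R e = sup (x - (?a + r *\<^sub>R e)) (- (r *\<^sub>R e))"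
      using lat.add_sup_distrib_right[of "x - ?a" 0 "- (r *\<^sub>R e)"] by (simp add: algebra_simps)
    then have "sup (?u - r *\<^sub>R e) 0 = sup (x - (real (Suc n) * r) *\<^sub>R e) 0"
      using nn unfolding sc by (simp add: sup.assoc sup_absorb2)
    then have "r *\<^sub>R q (Suc n) = r *\<^sub>R chi (sup (?u - r *\<^sub>R e) 0)" by (simp add: q_def)
    also have "\<dots> \<le> inf ?u (r *\<^sub>R e)" by (rule chi_le_inf_scaleR_unit[OF _ r]) simp
    finally show "r *\<^sub>R q (Suc n) \<le> inf x ((real (Suc n) * r) *\<^sub>R e) - inf x ?a" using eq by simp
    have "inf ?u (r *\<^sub>R e) \<le> r *\<^sub>R q n"
      unfolding q_def by (rule inf_scaleR_unit_le[OF _ r]) simp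
    then show "inf x ((real (Suc n) * r) *\<^sub>R e) - inf x ?a \<le> r *\<^sub>R q n" using eq by simp
  qed
  have tele: "(\<Sum>i<n. inf x ((real (Suc i) * r) *\<^sub>R e) - inf x ((real i * r) *\<^sub>R e))
      = inf x ((real n * r) *\<^sub>R e)" for n
  proof -
    have "inf x ((real 0 * r) *\<^sub>R e) = 0" using x(1) by (simp add: inf_absorb2)
    then show ?thesis
      by (simp only: sum_lessThan_telescope[of "\<lambda>i. inf x ((real i * r) *\<^sub>R e)" n] diff_zero)
  qed
  have top: "inf x ((real N * r) *\<^sub>R e) = x" using x by (simp add: inf_absorb1)
  have "(\<Sum>i<N. r *\<^sub>R q (Suc i)) \<le> inf x ((real N * r) *\<^sub>R e)"
    by (subst tele[of N, symmetric]) (intro sum_mono step)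
  then show "(\<Sum>i<N. r *\<^sub>R q (Suc i)) \<le> x" by (simp only: top)
  have q: "0 \<le> r *\<^sub>R q N" "r *\<^sub>R q 0 \<le> r *\<^sub>R e"
    using r chi_nonneg chi_le_unit by (auto simp: q_def scaleR_nonneg_nonneg intro: scaleR_left_mono)
  have "inf x ((real N * r) *\<^sub>R e) \<le> (\<Sum>i<N. r *\<^sub>R q i)"
    by (subst tele[of N, symmetric]) (intro sum_mono step)
  also have "\<dots> \<le> (\<Sum>i<Suc N. r *\<^sub>R q i)" using q by simp
  also have "\<dots> = (\<Sum>i<N. r *\<^sub>R q (Suc i)) + r *\<^sub>R q 0"
    by (simp only: sum.lessThan_Suc_shift add.commute)
  also have "\<dots> \<le> (\<Sum>i<N. r *\<^sub>R q (Suc i)) + r *\<^sub>R e" using q by simp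
  finally show "x \<le> (\<Sum>i<N. r *\<^sub>R q (Suc i)) + r *\<^sub>R e" by (simp only: top)
qed

text \<open>The component of e where g lies between a and b.\<close>

definition level :: "'a \<Rightarrow> real \<Rightarrow> real \<Rightarrow> 'a" where
  "level g a b = m (chi (sup (b *\<^sub>R e - g) 0)) (e - chi (sup (a *\<^sub>R e - g) 0))"

lemma component_level: "component (level g a b)"
  unfolding level_def by (intro component_m_component component_compl chi_pos_part)

text \<open>Each factor of \<open>level\<close> yields one inequality; for the upper bound the two
  factors are exchanged first.\<close>

lemma level_bounds:
  "a *\<^sub>R level g a b \<le> m (level g a b) g" "m (level g a b) g \<le> b *\<^sub>R level g a b"
proof -
  let ?p = "chi (sup (b *\<^sub>R e - g) 0)" and ?q = "e - chi (sup (a *\<^sub>R e - g) 0)"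
  have p: "component ?p" and q: "component ?q"
    by (intro component_compl chi_pos_part)+
  have "m ?p (m ?q (a *\<^sub>R e - g)) \<le> m ?p 0"
    by (intro component_m_mono p chi_pos_part)
  then have "m (level g a b) (a *\<^sub>R e - g) \<le> 0"
    unfolding level_def m_assoc by (simp add: m_zero_right)
  then show "a *\<^sub>R level g a b \<le> m (level g a b) g"
    by (simp add: m_diff_right m_scaleR_right m_unit)
  have "0 \<le> m ?q (m ?p (b *\<^sub>R e - g))"
    unfolding chi_pos_part(2) by (intro component_m_nonneg q) simp
  then have "0 \<le> m (level g a b) (b *\<^sub>R e - g)"
    unfolding level_def m_assoc by (subst component_m_left_commute[OF p q])
  then show "m (level g a b) g \<le> b *\<^sub>R level g a b"
    by (simp add: m_diff_right m_scaleR_right m_unit)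
qed

text \<open>The levels with a = k d show by induction that y vanishes where g < k d. Hence y lives
  where g exceeds every k d, and the Archimedean property, in place of finiteness of g, leaves only
  y = 0.\<close>

lemma eq_zero_if_zero_on_levels:
  assumes g: "0 \<le> g" and d: "0 < d" and y: "0 \<le> y"
    and zero: "\<And>a. 0 \<le> a \<Longrightarrow> m (level g a (a + d)) y \<le> 0"
  shows "y = 0"
proof -
  let ?u = "\<lambda>k::nat. sup ((real k * d) *\<^sub>R e - g) 0"
  have chi0: "m (chi (?u k)) y = 0" for k
  proof (induction k)
    case 0
    have "?u 0 = 0" using g by (simp add: sup_absorb2)
    then show ?case using y chi_m_disjoint[of 0 y] by (simp add: inf_absorb1)
  next
    case (Suc k)
    have "m (level g (real k * d) (real k * d + d)) y \<le> 0" using d by (intro zero) simp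
    then have "m (m (chi (?u (Suc k))) (e - chi (?u k))) y \<le> 0"
      by (simp add: level_def algebra_simps)
    then have "m (chi (?u (Suc k))) y \<le> 0"
      by (simp add: m_assoc m_diff_left m_unit Suc)
    then show ?case
      using component_m_nonneg[OF chi_pos_part(1) y] by (simp add: order.antisym)
  qed
  \<comment> \<open>Truncating y at d e puts k z - g below k d e - g as well as below k y; the
    positive part of the former is disjoint from the latter, whence k z \<le> g.\<close>
  let ?z = "inf y (d *\<^sub>R e)"
  have "real k *\<^sub>R ?z \<le> g" for k :: nat
  proof -
    have "y = m (e - chi (?u k)) y" using chi0[of k] by (simp add: m_diff_left m_unit)
    then have "inf (?u k) y = inf (m (chi (?u k)) (?u k)) (m (e - chi (?u k)) y)"
      by (simp add: chi_m_self)
    also have "\<dots> = 0" by (intro component_disjoint component_chi y) auto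
    finally have "inf y (?u k) = 0" by (simp add: inf.commute)
    then have "inf (m (real k *\<^sub>R e) y) (?u k) = 0"
      using unit_nonneg by (intro m_disjoint) (auto simp: scaleR_nonneg_nonneg)
    then have disj: "inf (real k *\<^sub>R y) (?u k) = 0" by (simp add: m_scaleR_left m_unit)
    have "real k *\<^sub>R ?z \<le> real k *\<^sub>R (d *\<^sub>R e)" by (intro scaleR_left_mono) auto
    then have 1: "real k *\<^sub>R ?z - g \<le> ?u k" by (simp add: le_supI1)
    have "real k *\<^sub>R ?z \<le> real k *\<^sub>R y" by (intro scaleR_left_mono) auto
    then have "real k *\<^sub>R ?z - g \<le> real k *\<^sub>R y"
      using g by (metis diff_right_mono diff_zero order_trans diff_left_mono)
    with 1 have "real k *\<^sub>R ?z - g \<le> inf (real k *\<^sub>R y) (?u k)" by simp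
    then show ?thesis unfolding disj by simp
  qed
  then have "?z \<le> 0" by (rule archimedean_le_zero)
  moreover have "0 \<le> ?z" using y d unit_nonneg by (simp add: scaleR_nonneg_nonneg)
  ultimately have "?z = 0" by (rule order.antisym)
  from m_eq_zero_of_disjoint[OF this] show ?thesis using d by (simp add: m_scaleR_right m_unit)
qed

end

section \<open>The ideal E and its band projections\<close>

locale f_algebra_ideal = unital_f_algebra +
  fixes E :: "'a set"
  assumes riesz: "riesz_subspace E"
    and solid: "\<And>x y. y \<in> E \<Longrightarrow> 0 \<le> x \<Longrightarrow> x \<le> y \<Longrightarrow> x \<in> E"
    and unit_in: "e \<in> E"
begin

lemma subspace: "subspace E" and sup_in: "x \<in> E \<Longrightarrow> y \<in> E \<Longrightarrow> sup x y \<in> E"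
  using riesz by (auto simp: riesz_subspace_def)

lemmas zero_in = subspace_0[OF subspace] and add_in = subspace_add[OF subspace]
  and diff_in = subspace_diff[OF subspace] and minus_in = subspace_neg[OF subspace]
  and scaleR_in = subspace_scale[OF subspace]

lemma absv_in: "x \<in> E \<Longrightarrow> absv x \<in> E"
  by (simp add: absv_def sup_in minus_in)

lemma in_if_absv_le:
  assumes "y \<in> E" "absv x \<le> y"
  shows "x \<in> E"
proof -
  have "0 \<le> y" using assms(2) absv_nonneg[of x] by (rule order_trans[rotated])
  then have "sup x 0 \<in> E" "sup (- x) 0 \<in> E"
    using assms by (auto simp: absv_le_iff intro!: solid[OF assms(1)])
  then show ?thesis using diff_in pos_part_minus_neg_part[of x] by metis
qed

lemma component_m_in: "component c \<Longrightarrow> x \<in> E \<Longrightarrow> m c x \<in> E"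
  using in_if_absv_le[OF absv_in component_absv_le_absv] .

text \<open>Solidity keeps the supremum formed in the whole type inside \<open>E\<close>, so the
  supremum relative to \<open>E\<close> is the ordinary one.\<close>

lemma is_sup_in_Sup:
  assumes "A \<noteq> {}" "\<And>a. a \<in> A \<Longrightarrow> 0 \<le> a \<and> a \<le> b" "b \<in> E"
  shows "is_sup_in E A (Sup A)"
proof -
  have "bdd_above A" using assms(2) by (intro bdd_aboveI[of _ b]) auto
  then have up: "a \<le> Sup A" if "a \<in> A" for a using that by (rule cSup_upper[rotated])
  have "Sup A \<le> b" using assms by (intro cSup_least) auto
  moreover have "0 \<le> Sup A" using assms up by (meson ex_in_conv order_trans)
  ultimately have "Sup A \<in> E" using solid assms(3) by blast
  then show ?thesis using up assms(1) by (auto simp: is_sup_in_def intro: cSup_least)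
qed

lemma is_inf_in_Inf:
  assumes "A \<noteq> {}" "A \<subseteq> E" "\<And>a. a \<in> A \<Longrightarrow> 0 \<le> a"
  shows "is_inf_in E A (Inf A)"
proof -
  have "bdd_below A" using assms(3) by (intro bdd_belowI[of _ 0]) auto
  then have low: "Inf A \<le> a" if "a \<in> A" for a using that by (rule cInf_lower[rotated])
  have "0 \<le> Inf A" using assms by (intro cInf_greatest) auto
  then have "Inf A \<in> E" using solid low assms by blast
  then show ?thesis using low assms(1) by (auto simp: is_inf_in_def intro: cInf_greatest)
qed

lemma sup_in_eq: "is_sup_in E A s \<Longrightarrow> sup_in E A = s"
  unfolding sup_in_def is_sup_in_def by (rule the_equality) (auto intro: order.antisym)

lemma inf_in_eq: "is_inf_in E A s \<Longrightarrow> inf_in E A = s"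
  unfolding inf_in_def is_inf_in_def by (rule the_equality) (auto intro: order.antisym)

text \<open>The fixed elements of multiplication by c are those annihilated by \<open>e - c\<close>,
  a condition inherited by dominated elements.\<close>

lemma band_in_component:
  assumes c: "component c"
  shows "band_in E {x \<in> E. m c x = x}"
proof -
  let ?B = "{x \<in> E. m c x = x}"
  have sub: "subspace ?B"
    by (auto simp: subspace_def zero_in add_in scaleR_in m_zero_right m_add_right m_scaleR_right)
  have "y \<in> ?B" if x: "x \<in> ?B" and y: "y \<in> E" "absv y \<le> absv x" for x y
  proof -
    have "absv x \<le> m c (absv x)" using component_absv_le[OF c, of x] x by simp
    then have "m (e - c) (absv x) \<le> 0" by (simp add: m_diff_left m_unit)
    moreover have "m (e - c) (absv y) \<le> m (e - c) (absv x)"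
      by (intro component_m_mono component_compl c y)
    ultimately have "absv (m (e - c) y) \<le> 0"
      using order_trans[OF component_absv_le[OF component_compl[OF c]]] order_trans by metis
    then have "m (e - c) y = 0" by (simp add: absv_le_iff order.antisym)
    then show ?thesis using y by (simp add: m_diff_left m_unit)
  qed
  with sub have ideal: "ideal_in E ?B" by (auto simp: ideal_in_def)
  have "s \<in> ?B" if A: "A \<subseteq> ?B" and s: "is_sup_in E A s" for A s
  proof (cases "A = {}")
    \<comment> \<open>An empty family has a supremum only if \<open>E\<close> has a least element,
      and that element must be 0.\<close>
    case True
    with s have s: "s \<in> E" "\<And>b. b \<in> E \<Longrightarrow> s \<le> b" by (auto simp: is_sup_in_def)
    have "s \<le> 0" "s \<le> s + s" by (intro s zero_in add_in)+
    then have "s = 0" by (intro order.antisym) simp_all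
    then show ?thesis by (simp add: zero_in m_zero_right)
  next
    case False
    then obtain a where a: "a \<in> A" by blast
    have s: "s \<in> E" "\<And>a. a \<in> A \<Longrightarrow> a \<le> s" "\<And>b. b \<in> E \<Longrightarrow> (\<And>a. a \<in> A \<Longrightarrow> a \<le> b) \<Longrightarrow> s \<le> b"
      using s unfolding is_sup_in_def by blast+
    have "b \<le> m c s" if "b \<in> A" for b
      using component_m_mono[OF c s(2)[OF that]] A that by auto
    then have "s \<le> m c s" using s(1) c by (intro s(3) component_m_in)
    \<comment> \<open>Any member a of the family gives 0 = (e - c) a \<le> (e - c) s, the reverse
      inequality c s \<le> s.\<close>
    moreover have "m (e - c) a \<le> m (e - c) s"
      by (intro component_m_mono component_compl c s(2) a)
    moreover have "m (e - c) a = 0" using a A by (auto simp: m_diff_left m_unit)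
    ultimately have "m c s = s" by (intro order.antisym) (simp_all add: m_diff_left m_unit)
    then show ?thesis using s(1) by simp
  qed
  with ideal show ?thesis unfolding band_in_def by blast
qed

text \<open>Supplies the members of \<open>BP\<close>: a component q in the range of V is the value
  at e of the band projection \<open>m q\<close>, so \<open>phi\<close> controls it.\<close>

lemma band_projection_component:
  assumes c: "component c"
  shows "band_projection E (m c)"
proof -
  have "m c x \<in> {x \<in> E. m c x = x}" if "x \<in> E" for x
    using that c by (simp add: component_m_in component_m_idem)
  moreover have "x - m c x \<in> disj_comp E {x \<in> E. m c x = x}" if x: "x \<in> E" for x
  proof -
    have "inf (absv (x - m c x)) (absv y) = 0" if y: "m c y = y" for y
    proof -
      have "absv (x - m c x) \<le> m (e - c) (absv x)"
        using component_absv_le[OF component_compl[OF c], of x] by (simp add: m_diff_left m_unit)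
      moreover have "absv y \<le> m c (absv y)" using component_absv_le[OF c, of y] y by simp
      ultimately have "inf (absv (x - m c x)) (absv y) \<le> inf (m (e - c) (absv x)) (m c (absv y))"
        by (rule inf_mono)
      also have "\<dots> = 0"
        using component_disjoint[OF c absv_nonneg absv_nonneg] by (simp add: inf.commute)
      finally show ?thesis by (simp add: order.antisym absv_nonneg)
    qed
    then show ?thesis using x c by (auto simp: disj_comp_def diff_in component_m_in)
  qed
  ultimately show ?thesis
    unfolding band_projection_def using band_in_component[OF c] by blast
qed

lemma band_projection_unit:
  assumes "band_projection E Q"
  shows "Q e \<in> E" "0 \<le> Q e" "Q e \<le> e"
proof -
  obtain B where B: "band_in E B" "Q e \<in> B" "e - Q e \<in> disj_comp E B"
    using assms unit_in by (auto simp: band_projection_def)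
  then show "Q e \<in> E" by (auto simp: band_in_def ideal_in_def)
  have "inf (absv (e - Q e)) (absv (Q e)) = 0" using B by (auto simp: disj_comp_def)
  then show "0 \<le> Q e" "Q e \<le> e"
    using nonneg_of_disjoint_summands[of "Q e" "e - Q e"]
      nonneg_of_disjoint_summands[of "e - Q e" "Q e"] unit_nonneg
    by (simp_all add: inf.commute)
qed

end

section \<open>Strictly positive expectations and their ranges\<close>

locale expectation = f_algebra_ideal +
  fixes S :: "'a \<Rightarrow> 'a"
  assumes linear: "linear_on E S" and positive: "positive_on E S"
    and idem: "\<And>x. x \<in> E \<Longrightarrow> S (S x) = S x"
    and riesz_range: "riesz_subspace (S ` E)"
    and strict: "\<And>x. x \<in> E \<Longrightarrow> 0 \<le> x \<Longrightarrow> S x = 0 \<Longrightarrow> x = 0"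
    and S_unit: "S e = e"
begin

lemma S_in: "x \<in> E \<Longrightarrow> S x \<in> E"
  and S_add: "x \<in> E \<Longrightarrow> y \<in> E \<Longrightarrow> S (x + y) = S x + S y"
  and S_scaleR: "x \<in> E \<Longrightarrow> S (r *\<^sub>R x) = r *\<^sub>R S x"
  using linear by (auto simp: linear_on_def)

lemma S_minus: "x \<in> E \<Longrightarrow> S (- x) = - S x"
  using S_scaleR[of x "-1"] by simp

lemma S_diff: "x \<in> E \<Longrightarrow> y \<in> E \<Longrightarrow> S (x - y) = S x - S y"
  using S_add[of x "- y"] by (simp add: S_minus minus_in)

lemma S_sum: "(\<And>i. i \<in> I \<Longrightarrow> x i \<in> E) \<Longrightarrow> S (\<Sum>i\<in>I. x i) = (\<Sum>i\<in>I. S (x i))"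
proof (induction I rule: infinite_finite_induct)
  case (insert i I)
  then show ?case by (simp add: S_add subspace_sum[OF subspace])
qed (use S_scaleR[OF zero_in, of 0] in simp_all)

lemma S_mono: "x \<in> E \<Longrightarrow> y \<in> E \<Longrightarrow> x \<le> y \<Longrightarrow> S x \<le> S y"
  using positive S_diff[of y x] diff_in[of y x] by (auto simp: positive_on_def)

lemma range_iff: "x \<in> S ` E \<longleftrightarrow> x \<in> E \<and> S x = x"
  by (auto simp: S_in idem intro: rev_image_eqI)

lemma range_subspace: "subspace (S ` E)"
  and range_sup: "x \<in> S ` E \<Longrightarrow> y \<in> S ` E \<Longrightarrow> sup x y \<in> S ` E"
  using riesz_range by (auto simp: riesz_subspace_def)

lemmas range_add = subspace_add[OF range_subspace] and range_diff = subspace_diff[OF range_subspace]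
  and range_scaleR = subspace_scale[OF range_subspace] and range_minus = subspace_neg[OF range_subspace]
  and range_zero = subspace_0[OF range_subspace]

lemma range_inf: "x \<in> S ` E \<Longrightarrow> y \<in> S ` E \<Longrightarrow> inf x y \<in> S ` E"
  using range_minus[OF range_sup[OF range_minus range_minus], of x y]
  by (simp add: lat.neg_sup_eq_inf)

lemma range_unit: "e \<in> S ` E"
  using S_unit unit_in by (simp add: range_iff)

lemma absv_S_le:
  assumes "x \<in> E" "g \<in> S ` E" "absv x \<le> g"
  shows "absv (S x) \<le> g"
  using assms S_mono[of x g] S_mono[of "- x" g] by (auto simp: absv_le_iff range_iff S_minus minus_in)

text \<open>Strict positivity makes an element that S moves only upwards, or only downwards, a fixed
  point; hence the range is closed under suprema and infima.\<close>

lemma range_if_le_S: "x \<in> E \<Longrightarrow> x \<le> S x \<Longrightarrow> x \<in> S ` E"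
  using strict[of "S x - x"] S_diff[of "S x" x] by (simp add: range_iff diff_in S_in idem)

lemma range_if_S_le: "x \<in> E \<Longrightarrow> S x \<le> x \<Longrightarrow> x \<in> S ` E"
  using strict[of "x - S x"] S_diff[of x "S x"] by (simp add: range_iff diff_in S_in idem)

lemma is_sup_in_range:
  assumes "A \<subseteq> S ` E" "is_sup_in E A s"
  shows "s \<in> S ` E"
proof -
  have s: "s \<in> E" "\<And>a. a \<in> A \<Longrightarrow> a \<le> s" "\<And>b. b \<in> E \<Longrightarrow> (\<And>a. a \<in> A \<Longrightarrow> a \<le> b) \<Longrightarrow> s \<le> b"
    using assms(2) unfolding is_sup_in_def by blast+
  have "a \<le> S s" if "a \<in> A" for a
    using S_mono[OF _ s(1) s(2)[OF that]] assms(1) that range_iff by (metis subsetD)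
  then show ?thesis using s by (intro range_if_le_S s(3) S_in)
qed

lemma is_inf_in_range:
  assumes "A \<subseteq> S ` E" "is_inf_in E A s"
  shows "s \<in> S ` E"
proof -
  have s: "s \<in> E" "\<And>a. a \<in> A \<Longrightarrow> s \<le> a" "\<And>b. b \<in> E \<Longrightarrow> (\<And>a. a \<in> A \<Longrightarrow> b \<le> a) \<Longrightarrow> b \<le> s"
    using assms(2) unfolding is_inf_in_def by blast+
  have "S s \<le> a" if "a \<in> A" for a
    using S_mono[OF s(1) _ s(2)[OF that]] assms(1) that range_iff by (metis subsetD)
  then show ?thesis using s by (intro range_if_S_le s(3) S_in)
qed

lemma range_chi:
  assumes "u \<in> S ` E" "0 \<le> u"
  shows "chi u \<in> S ` E"
proof (rule is_sup_in_range)
  let ?A = "range (\<lambda>n::nat. inf (real n *\<^sub>R u) e)"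
  show "?A \<subseteq> S ` E" using assms(1) by (auto intro!: range_inf range_scaleR range_unit)
  show "is_sup_in E ?A (chi u)"
    unfolding chi_def using assms(2) unit_nonneg unit_in
    by (intro is_sup_in_Sup) (auto simp: scaleR_nonneg_nonneg)
qed

lemma range_chi_pos_part: "u \<in> S ` E \<Longrightarrow> chi (sup u 0) \<in> S ` E"
  by (intro range_chi range_sup range_zero) simp_all

lemma range_component_m:
  assumes "component c" "c \<in> S ` E" "0 \<le> x" "x \<in> S ` E" "0 \<le> r" "m c x \<le> r *\<^sub>R c"
  shows "m c x \<in> S ` E"
  using component_m_eq_inf[of c x r] assms by (simp add: range_inf range_scaleR)

lemma range_level: "g \<in> S ` E \<Longrightarrow> level g a b \<in> S ` E"
  unfolding level_def
  by (subst component_m_component(1))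
    (auto intro!: range_inf range_diff range_unit range_chi_pos_part range_scaleR
      component_compl chi_pos_part)

text \<open>The averaging identity for a component. Since c g and (e - c) g are fixed by S and
  dominate the two pieces of x, they also dominate the images of these pieces; thus S keeps each
  piece on its own side of c.\<close>

lemma S_component_m:
  assumes c: "component c" "c \<in> S ` E" and g: "g \<in> S ` E" "0 \<le> r" "m c g \<le> r *\<^sub>R c"
    and x: "x \<in> E" "absv x \<le> g"
  shows "S (m c x) = m c (S x)"
proof -
  have g0: "0 \<le> g" using absv_nonneg x(2) by (rule order_trans)
  have cg: "m c g \<in> S ` E" using range_component_m c g0 g by blast
  then have dg: "m (e - c) g \<in> S ` E" using g by (simp add: m_diff_left m_unit range_diff)
  have E: "m c x \<in> E" "m (e - c) x \<in> E" using c x by (auto intro: component_m_in component_compl)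
  have "absv (m d x) \<le> m d g" if "component d" for d
    using component_absv_le[OF that] component_m_mono[OF that x(2)] by (rule order_trans)
  then have 1: "absv (S (m c x)) \<le> m c g" and 2: "absv (S (m (e - c) x)) \<le> m (e - c) g"
    using c component_compl E cg dg by (auto intro!: absv_S_le)
  have "absv (m (e - c) (S (m c x))) \<le> m (e - c) (absv (S (m c x)))"
    using component_absv_le component_compl c by blast
  also have "\<dots> \<le> m (e - c) (m c g)" by (intro component_m_mono component_compl c 1)
  also have "\<dots> = 0" by (simp add: m_diff_left m_unit component_m_idem[OF c(1)])
  finally have A: "m (e - c) (S (m c x)) = 0" by (simp add: absv_le_iff order.antisym)
  have "absv (m c (S (m (e - c) x))) \<le> m c (absv (S (m (e - c) x)))"
    using component_absv_le c by blast
  also have "\<dots> \<le> m c (m (e - c) g)" by (intro component_m_mono c 2)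
  also have "\<dots> = 0" by (rule component_m_compl[OF c(1)])
  finally have B: "m c (S (m (e - c) x)) = 0" by (simp add: absv_le_iff order.antisym)
  have "m c (S x) = m c (S (m c x) + S (m (e - c) x))"
    using S_add[OF E] component_split[of c x] by simp
  also have "\<dots> = m c (S (m c x))" by (simp add: m_add_right B)
  also have "\<dots> = S (m c x)" using A by (simp add: m_diff_left m_unit)
  finally show ?thesis by simp
qed

text \<open>The infimum is attained: the range is closed under infima, so the norm is itself the
  least admissible bound.\<close>

lemma norm_Tinf_props:
  assumes "f \<in> Linf E S"
  shows "norm_Tinf E S f \<in> S ` E" "absv f \<le> norm_Tinf E S f"
    "\<And>g. g \<in> S ` E \<Longrightarrow> absv f \<le> g \<Longrightarrow> norm_Tinf E S f \<le> g"
proof -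
  let ?G = "{g \<in> S ` E. 0 \<le> g \<and> absv f \<le> g}"
  have "is_inf_in E ?G (Inf ?G)"
    using assms S_in by (intro is_inf_in_Inf) (auto simp: Linf_def)
  then have inf: "is_inf_in E ?G (norm_Tinf E S f)"
    unfolding norm_Tinf_def using inf_in_eq by simp
  then show "norm_Tinf E S f \<in> S ` E" by (rule is_inf_in_range[rotated]) auto
  show "absv f \<le> norm_Tinf E S f"
    using inf assms absv_in by (auto simp: is_inf_in_def Linf_def)
  fix g assume "g \<in> S ` E" "absv f \<le> g"
  then have "g \<in> ?G" using absv_nonneg order_trans by blast
  then show "norm_Tinf E S f \<le> g" using inf by (auto simp: is_inf_in_def)
qed

lemma LinfI: "f \<in> E \<Longrightarrow> g \<in> S ` E \<Longrightarrow> absv f \<le> g \<Longrightarrow> f \<in> Linf E S"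
  unfolding Linf_def using absv_nonneg order_trans by blast

end

section \<open>Comparison of U and T on the range of V\<close>

locale compatible_expectations =
  T: expectation m e E T + U: expectation m e E U + V: expectation m e E V
  for m :: "'a::{ordered_real_vector, conditionally_complete_lattice} \<Rightarrow> 'a \<Rightarrow> 'a" and e E T U V +
  assumes UT: "\<And>x. x \<in> E \<Longrightarrow> U (T x) = T x" and VT: "\<And>x. x \<in> E \<Longrightarrow> V (T x) = T x"
begin

lemma range_T_U: "g \<in> T ` E \<Longrightarrow> g \<in> U ` E" and range_T_V: "g \<in> T ` E \<Longrightarrow> g \<in> V ` E"
  using UT VT by (metis T.range_iff U.range_iff, metis T.range_iff V.range_iff)

text \<open>U and T both fix g, so U x and T x lie between 0 and g and differ by at most g;
  positivity of x avoids a factor 2.\<close>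

lemma diff_le:
  assumes "x \<in> E" "g \<in> T ` E" "0 \<le> x" "x \<le> g"
  shows "absv (U x - T x) \<le> g"
proof -
  have "absv x \<le> g" using assms by (simp add: absv_of_nonneg)
  then have "U x \<le> g" "T x \<le> g"
    using U.absv_S_le[OF assms(1)] T.absv_S_le[OF assms(1)] range_T_U assms(2)
    by (auto simp: absv_le_iff)
  moreover have "0 \<le> U x" "0 \<le> T x"
    using assms U.positive T.positive by (auto simp: positive_on_def)
  ultimately show ?thesis
    by (auto simp: absv_le_iff diff_le_eq intro: order_trans add_increasing2)
qed

text \<open>A crude bound: it shows that the norm of the difference has the expected properties, and
  later that this norm is bounded on a level.\<close>

lemma norm_diff_le:
  assumes "f \<in> Linf E T"
  shows "U f - T f \<in> Linf E T" "norm_Tinf E T (U f - T f) \<le> 2 *\<^sub>R norm_Tinf E T f"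
proof -
  let ?g = "norm_Tinf E T f"
  have f: "f \<in> E" using assms by (simp add: Linf_def)
  note g = T.norm_Tinf_props[OF assms]
  have "absv (U f) \<le> ?g" "absv (T f) \<le> ?g"
    using U.absv_S_le T.absv_S_le f g range_T_U by auto
  then have bounds: "U f \<le> ?g" "- U f \<le> ?g" "T f \<le> ?g" "- T f \<le> ?g" by (auto simp: absv_le_iff)
  have le: "absv (U f - T f) \<le> 2 *\<^sub>R ?g"
    using add_mono[OF bounds(1,4)] add_mono[OF bounds(3,2)] by (simp add: absv_le_iff scaleR_2)
  have g2: "2 *\<^sub>R ?g \<in> T ` E" using g by (intro T.range_scaleR)
  show L: "U f - T f \<in> Linf E T"
    using le g2 f by (intro T.LinfI T.diff_in U.S_in T.S_in)
  show "norm_Tinf E T (U f - T f) \<le> 2 *\<^sub>R ?g"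
    using T.norm_Tinf_props(3)[OF L g2 le] .
qed

abbreviation mixing where "mixing \<equiv> phi E e T U V"

lemma phi_props:
  "mixing \<in> T ` E" "0 \<le> mixing" "mixing \<le> e"
  "\<And>q. T.component q \<Longrightarrow> q \<in> V ` E \<Longrightarrow> absv (U q - T q) \<le> mixing"
proof -
  let ?N = "\<lambda>Q. norm_Tinf E T (U (Q e) - T (Q e))"
  let ?A = "?N ` BP E e V"
  have Q: "?N Q \<in> T ` E \<and> absv (U (Q e) - T (Q e)) \<le> ?N Q \<and> ?N Q \<le> e"
    if "Q \<in> BP E e V" for Q
  proof -
    have q: "Q e \<in> E" "0 \<le> Q e" "Q e \<le> e"
      using that T.band_projection_unit by (auto simp: BP_def)
    have le: "absv (U (Q e) - T (Q e)) \<le> e" using q T.range_unit by (intro diff_le)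
    then have "U (Q e) - T (Q e) \<in> Linf E T"
      using q T.range_unit by (intro T.LinfI T.diff_in U.S_in T.S_in)
    from T.norm_Tinf_props[OF this] le T.range_unit show ?thesis by blast
  qed
  have comp: "m q \<in> BP E e V" if "T.component q" "q \<in> V ` E" for q
    using that T.band_projection_component by (simp add: BP_def T.m_unit)
  \<comment> \<open>The identity projection makes the family nonempty.\<close>
  have "T.component e" using T.unit_nonneg by (simp add: T.component_def inf_absorb2)
  then have ne: "m e \<in> BP E e V" using comp V.range_unit by blast
  have nn: "0 \<le> ?N Q" if "Q \<in> BP E e V" for Q using Q[OF that] absv_nonneg order_trans by blast
  have "is_sup_in E ?A (Sup ?A)"
    using ne nn Q T.unit_in by (intro T.is_sup_in_Sup[of _ e]) auto
  then have sup: "is_sup_in E ?A mixing"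
    unfolding phi_def using T.sup_in_eq by simp
  show "mixing \<in> T ` E" using Q by (intro T.is_sup_in_range[OF _ sup]) auto
  have up: "?N Q \<le> mixing" if "Q \<in> BP E e V" for Q using sup that by (auto simp: is_sup_in_def)
  show "0 \<le> mixing" using nn[OF ne] up[OF ne] by (rule order_trans)
  show "mixing \<le> e" using sup Q T.unit_in by (auto simp: is_sup_in_def)
  fix q assume q: "T.component q" "q \<in> V ` E"
  then show "absv (U q - T q) \<le> mixing"
    using Q[OF comp[OF q]] up[OF comp[OF q]] by (auto simp: T.m_unit intro: order_trans)
qed

lemma diff_le_scaleR_phi:
  assumes f: "f \<in> V ` E" "absv f \<le> b *\<^sub>R e" and b: "0 \<le> b"
  shows "absv (U f - T f) \<le> (2 * b) *\<^sub>R mixing"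
proof -
  have fE: "f \<in> E" using f by (simp add: V.range_iff)
  \<comment> \<open>The layer cake needs a nonnegative element. The shift is invisible to U - T, as
    both fix e, but it doubles the height to 2 b.\<close>
  let ?x = "f + b *\<^sub>R e"
  have bE: "b *\<^sub>R e \<in> E" by (intro T.scaleR_in T.unit_in)
  have xV: "?x \<in> V ` E" by (intro V.range_add V.range_scaleR V.range_unit f)
  then have xE: "?x \<in> E" by (simp add: V.range_iff)
  have Ux: "U ?x - T ?x = U f - T f"
    using fE bE by (simp add: U.S_add T.S_add U.S_scaleR T.S_scaleR T.unit_in U.S_unit T.S_unit)
  have x: "0 \<le> ?x" "?x \<le> (2 * b) *\<^sub>R e"
  proof -
    have "- f \<le> b *\<^sub>R e" "f \<le> b *\<^sub>R e" using f(2) unfolding absv_le_iff by auto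
    from add_left_mono[OF this(1), of f] add_right_mono[OF this(2), of "b *\<^sub>R e"]
    show "0 \<le> ?x" "?x \<le> (2 * b) *\<^sub>R e"
      by (simp_all only: right_minus mult_2 scaleR_left_distrib)
  qed
  have "absv (U f - T f) \<le> (2 * b) *\<^sub>R mixing + (1 / real N) *\<^sub>R ((2 * b) *\<^sub>R e)"
    if N: "0 < N" for N :: nat
  proof -
    \<comment> \<open>N layers of height r exactly fill the height 2 b, so the weights in the sum
      total 2 b.\<close>
    define r where "r = 2 * b / real N"
    define q where "q i = T.chi (sup (?x - (real i * r) *\<^sub>R e) 0)" for i :: nat
    define s where "s = (\<Sum>i<N. r *\<^sub>R q (Suc i))"
    have r: "0 \<le> r" "real N * r = 2 * b" using b N by (auto simp: r_def)
    have s_le: "s \<le> ?x" "?x \<le> s + r *\<^sub>R e"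
      using T.layer_cake[of ?x N r] x r by (simp_all add: s_def q_def)
    have q: "T.component (q i)" "q i \<in> V ` E" for i
      unfolding q_def
      by (auto intro!: T.chi_pos_part V.range_chi_pos_part V.range_diff V.range_scaleR V.range_unit xV)
    then have qE: "q i \<in> E" for i by (simp add: V.range_iff)
    then have rqE: "r *\<^sub>R q i \<in> E" for i by (rule T.scaleR_in)
    have sE: "s \<in> E" unfolding s_def by (intro subspace_sum[OF T.subspace] rqE)
    have Us: "U s - T s = (\<Sum>i<N. r *\<^sub>R (U (q (Suc i)) - T (q (Suc i))))"
      unfolding s_def
      by (simp add: U.S_sum T.S_sum rqE qE U.S_scaleR T.S_scaleR sum_subtractf scaleR_diff_right)
    have q_le: "U (q i) - T (q i) \<le> mixing" "- (U (q i) - T (q i)) \<le> mixing" for i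
      using phi_props(4)[OF q] unfolding absv_le_iff by auto
    have const: "(\<Sum>i<N. r *\<^sub>R mixing) = (2 * b) *\<^sub>R mixing"
      using r(2) by (simp add: sum_constant_scaleR)
    have s1: "U s - T s \<le> (2 * b) *\<^sub>R mixing"
      unfolding Us const[symmetric] by (intro sum_mono scaleR_left_mono q_le r)
    have "- (U s - T s) = (\<Sum>i<N. r *\<^sub>R - (U (q (Suc i)) - T (q (Suc i))))"
      unfolding Us by (simp only: sum_negf[symmetric] scaleR_minus_right)
    also have "\<dots> \<le> (2 * b) *\<^sub>R mixing"
      unfolding const[symmetric] by (intro sum_mono scaleR_left_mono q_le r)
    finally have s2: "- (U s - T s) \<le> (2 * b) *\<^sub>R mixing" .
    \<comment> \<open>The remainder lies between 0 and r e, hence U - T maps it into the same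
      scale.\<close>
    have "absv (U (?x - s) - T (?x - s)) \<le> r *\<^sub>R e"
      using s_le by (intro diff_le T.diff_in xE sE T.range_scaleR T.range_unit) (auto simp: algebra_simps)
    then have d: "U (?x - s) - T (?x - s) \<le> r *\<^sub>R e" "- (U (?x - s) - T (?x - s)) \<le> r *\<^sub>R e"
      unfolding absv_le_iff by auto
    have dec: "U f - T f = (U s - T s) + (U (?x - s) - T (?x - s))"
      unfolding Ux[symmetric] by (simp add: U.S_diff T.S_diff xE sE)
    have "absv (U f - T f) \<le> (2 * b) *\<^sub>R mixing + r *\<^sub>R e"
      using add_mono[OF s1 d(1)] add_mono[OF s2 d(2)] unfolding dec absv_le_iff
      by (simp add: algebra_simps)
    then show ?thesis by (simp add: r_def)
  qed
  then show ?thesis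
    by (rule le_of_le_add_scaleR) (use b T.unit_nonneg in \<open>auto simp: scaleR_nonneg_nonneg\<close>)
qed

text \<open>The norm is an infimum over global bounds, so it is localized by a competitor: keep the
  norm off c and use the estimate for c f on c. The result \<open>?w\<close> dominates the
  difference and lies in the range of T, so minimality of the norm applies.\<close>

lemma norm_diff_le_on_component:
  assumes f: "f \<in> Linf E T" "f \<in> V ` E"
    and c: "T.component c" "c \<in> T ` E" and b: "0 \<le> b" "m c (norm_Tinf E T f) \<le> b *\<^sub>R c"
  shows "m c (norm_Tinf E T (U f - T f)) \<le> (2 * b) *\<^sub>R m c mixing"
proof -
  let ?g = "norm_Tinf E T f" and ?h = "U f - T f"
  let ?k = "norm_Tinf E T ?h"
  have fE: "f \<in> E" using f by (simp add: Linf_def)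
  note g = T.norm_Tinf_props[OF f(1)]
  note k = T.norm_Tinf_props[OF norm_diff_le(1)[OF f(1)]]
  have k0: "0 \<le> ?k" using absv_nonneg k(2) by (rule order_trans)
  have cf: "m c f \<in> V ` E"
    using V.S_component_m[OF c(1) _ _ b fE g(2)] c g range_T_V f T.component_m_in[OF c(1) fE]
    by (simp add: V.range_iff)
  have "absv (m c f) \<le> m c ?g"
    using T.component_absv_le[OF c(1)] T.component_m_mono[OF c(1) g(2)] by (rule order_trans)
  also have "\<dots> \<le> b *\<^sub>R e"
    using b(2) scaleR_left_mono[OF T.component_le_unit[OF c(1)] b(1)] by (rule order_trans)
  finally have "absv (U (m c f) - T (m c f)) \<le> (2 * b) *\<^sub>R mixing"
    by (intro diff_le_scaleR_phi cf b)
  moreover have "U (m c f) - T (m c f) = m c ?h"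
    using U.S_component_m[OF c(1) _ _ b fE g(2)] T.S_component_m[OF c _ b fE g(2)] c g range_T_U
    by (simp add: T.m_diff_right)
  ultimately have "absv (m c ?h) \<le> (2 * b) *\<^sub>R mixing" by simp
  then have ch: "m c ?h \<le> (2 * b) *\<^sub>R m c mixing" "m c (- ?h) \<le> (2 * b) *\<^sub>R m c mixing"
    using T.component_m_mono[OF c(1), of "m c ?h" "(2 * b) *\<^sub>R mixing"]
      T.component_m_mono[OF c(1), of "m c (- ?h)" "(2 * b) *\<^sub>R mixing"]
    unfolding absv_le_iff T.component_m_idem[OF c(1)] T.m_scaleR_right T.m_minus_right by blast+
  let ?w = "m (e - c) ?k + (2 * b) *\<^sub>R m c mixing"
  have split: "z \<le> ?w" if "z \<le> ?k" "m c z \<le> (2 * b) *\<^sub>R m c mixing" for z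
  proof -
    have "m (e - c) z \<le> m (e - c) ?k" by (intro T.component_m_mono T.component_compl c that)
    from add_mono[OF this that(2)] show ?thesis
      using T.component_split[of c z] by (simp add: add.commute)
  qed
  have "?h \<le> ?k" "- ?h \<le> ?k" using k(2) unfolding absv_le_iff by auto
  then have "absv ?h \<le> ?w" using split ch unfolding absv_le_iff by blast
  moreover have "?w \<in> T ` E"
  proof -
    \<comment> \<open>To place c k in the range of T it must be bounded by a multiple of c; the
      crude estimate provides this.\<close>
    have "m c ?k \<le> m c (2 *\<^sub>R ?g)" by (intro T.component_m_mono c norm_diff_le f)
    also have "\<dots> \<le> (2 * b) *\<^sub>R c"
      using scaleR_left_mono[OF b(2), of 2] by (simp add: T.m_scaleR_right)
    finally have "m c ?k \<in> T ` E" using b by (intro T.range_component_m[of _ _ "2 * b"] c k0 k) auto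
    moreover have "m c mixing \<le> 1 *\<^sub>R c"
      using T.component_m_mono[OF c(1) phi_props(3)] by (simp add: T.m_unit)
    then have "m c mixing \<in> T ` E" by (intro T.range_component_m[of _ _ 1] c phi_props) auto
    ultimately show ?thesis
      using k(1) by (simp add: T.m_diff_left T.m_unit T.range_add T.range_diff T.range_scaleR)
  qed
  ultimately have "?k \<le> ?w" by (intro k(3))
  then show ?thesis using T.component_split[of c ?k] by (metis add.commute add_le_cancel_left)
qed

text \<open>On the level a \<le> g \<le> a + d the constant b = a + d exceeds g by at most d, which
  costs at most 2 d e as phi \<le> e. The levels are recombined by testing the positive part of the
  excess on each of them, without an infinite sum.\<close>

lemma norm_diff_le_phi:
  assumes f: "f \<in> Linf E T" "f \<in> V ` E"
  shows "norm_Tinf E T (U f - T f) \<le> 2 *\<^sub>R m mixing (norm_Tinf E T f)"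
proof -
  let ?g = "norm_Tinf E T f" and ?k = "norm_Tinf E T (U f - T f)"
  note g = T.norm_Tinf_props[OF f(1)]
  have g0: "0 \<le> ?g" using absv_nonneg g(2) by (rule order_trans)
  have "?k \<le> 2 *\<^sub>R m mixing ?g + (1 / real n) *\<^sub>R (2 *\<^sub>R e)" if n: "0 < n" for n :: nat
  proof -
    let ?d = "1 / real n"
    let ?w = "?k - (2 *\<^sub>R m mixing ?g + ?d *\<^sub>R (2 *\<^sub>R e))"
    have "sup ?w 0 = 0"
    proof (rule T.eq_zero_if_zero_on_levels[OF g0, of ?d])
      fix a :: real assume a: "0 \<le> a"
      let ?c = "T.level ?g a (a + ?d)"
      have c: "T.component ?c" by (rule T.component_level)
      have "m ?c ?k \<le> (2 * (a + ?d)) *\<^sub>R m ?c mixing"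
        using a by (intro norm_diff_le_on_component f c T.range_level g T.level_bounds) auto
      also have "\<dots> = 2 *\<^sub>R (a *\<^sub>R m ?c mixing) + (2 * ?d) *\<^sub>R m ?c mixing"
        by (simp add: algebra_simps)
      also have "\<dots> \<le> 2 *\<^sub>R m ?c (m mixing ?g) + (2 * ?d) *\<^sub>R m ?c e"
      proof (intro add_mono scaleR_left_mono)
        have "a *\<^sub>R m ?c mixing = m mixing (a *\<^sub>R ?c)"
          using T.component_m_commute[OF c phi_props(2)] by (simp add: T.m_scaleR_right)
        also have "\<dots> \<le> m mixing (m ?c ?g)" by (intro T.m_mono_right phi_props T.level_bounds)
        also have "\<dots> = m ?c (m mixing ?g)"
          using T.component_m_commute[OF c phi_props(2)] by (simp flip: T.m_assoc)
        finally show "a *\<^sub>R m ?c mixing \<le> m ?c (m mixing ?g)" .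
        show "m ?c mixing \<le> m ?c e" by (intro T.component_m_mono c phi_props)
      qed auto
      finally have "m ?c ?w \<le> 0"
        by (simp add: T.m_diff_right T.m_add_right T.m_scaleR_right T.m_unit mult.commute)
      then show "m ?c (sup ?w 0) \<le> 0" by (rule T.component_m_pos_part_le[OF c])
    qed (use n in auto)
    then have "?w \<le> 0" by (metis sup_ge1)
    then show ?thesis by simp
  qed
  then show ?thesis
    by (rule le_of_le_add_scaleR) (use T.unit_nonneg in \<open>auto simp: scaleR_nonneg_nonneg\<close>)
qed

end

theorem theorem4p10:
  fixes E :: "'a::{ordered_real_vector, conditionally_complete_lattice} set"
    and e :: 'a and T U V :: "'a \<Rightarrow> 'a" and mult :: "'a \<Rightarrow> 'a \<Rightarrow> 'a" and f :: 'a
  assumes "universal_completion E"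
    and "dedekind_complete_in E"
    and "weak_order_unit E e"
    and "f_algebra_unit mult e"
    and "cond_exp E T" and "strictly_positive E T" and "T e = e"
    and "T_universally_complete E T"
    and "compatible E T U" and "compatible E T V"
    and "f \<in> Linf E T" and "f \<in> V ` E"
  shows "norm_T1 T (U f - T f) \<le> norm_Tinf E T (U f - T f) \<and>
         norm_Tinf E T (U f - T f) \<le> 2 *\<^sub>R mult (phi E e T U V) (norm_Tinf E T f)"
proof -
  have e: "e \<in> E" "0 \<le> e" using assms(3) by (auto simp: weak_order_unit_def)
  interpret I: f_algebra_ideal mult e E
  proof
    show "riesz_subspace E" using assms(1) by (simp add: universal_completion_def)
    show "x \<in> E" if "y \<in> E" "0 \<le> x" "x \<le> y" for x y
      using dedekind_complete_order_dense_solid[OF _ _ assms(2) that] assms(1)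
      by (simp add: universal_completion_def)
  qed (use assms(4) e in auto)
  have strictT: "x = 0" if "x \<in> E" "0 \<le> x" "T x = 0" for x
    using assms(6) that by (simp add: strictly_positive_def absv_of_nonneg)
  have T0: "T 0 = 0"
    using assms(5) I.zero_in unfolding cond_exp_def linear_on_def by (metis scale_zero_left)
  \<comment> \<open>Compatibility transfers two properties from T to S: S e = S (T e) = T e = e, and
    S x = 0 gives T x = T (S x) = T 0 = 0.\<close>
  have exp: "expectation mult e E S" if S: "compatible E T S" for S
  proof
    show "S e = e" using S e(1) assms(7) unfolding compatible_def by metis
    show "x = 0" if "x \<in> E" "0 \<le> x" "S x = 0" for x
      using S that strictT[of x] T0 unfolding compatible_def by metis
  qed (use S in \<open>auto simp: compatible_def cond_exp_def\<close>)
  have "compatible E T T" using assms(5) by (simp add: compatible_def cond_exp_def)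
  then interpret compatible_expectations mult e E T U V
    using exp assms(9,10)
    by (simp add: compatible_expectations_def compatible_expectations_axioms_def compatible_def)
  note k = T.norm_Tinf_props[OF norm_diff_le(1)[OF assms(11)]]
  have h: "U f - T f \<in> E" using norm_diff_le(1)[OF assms(11)] by (simp add: Linf_def)
  \<comment> \<open>T fixes the norm on the right because the norm lies in its range.\<close>
  have "T (absv (U f - T f)) \<le> T (norm_Tinf E T (U f - T f))"
    using k h by (intro T.S_mono I.absv_in) (auto simp: T.range_iff)
  then have "norm_T1 T (U f - T f) \<le> norm_Tinf E T (U f - T f)"
    using k(1) by (simp add: norm_T1_def T.range_iff)
  then show ?thesis using norm_diff_le_phi assms(11,12) by blast
qed

end
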